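(* Let $A$ be a right-cancellable protomodular algebra (with protomodular operations $\theta,\alpha_1,\dots,\alpha_n,e_1,\dots,e_n$), and let $u$ be an arbitrary element of $A$. Then the binary operation on $A$ defined by $$a\cdot_{u}b=\theta(\alpha_{1}(a,u),\alpha_{2}(a,u),\dots,\alpha_{n}(a,u),b)$$ is a group operation. Its unit is $u$, and the inverse of an element $a\in A$ under this operation is given by $$a^{-_{u}1}=\theta(\alpha_{1}(u,a),\alpha_{2}(u,a),\dots,\alpha_{n}(u,a),u).$$
   Context: Fix a natural number $n\geq 1$. A protomodular algebra is an algebra $A$ from a variety of universal algebras whose algebraic theory contains protomodular terms, i.e. 0-ary terms $e_1,\dots,e_n$, binary terms $\alpha_1,\dots,\alpha_n$ and an $(n+1)$-ary term $\theta$ satisfying the identities $$\alpha_i(a,a)=e_i\quad (1\le i\le n),\qquad \theta(\alpha_1(a,b),\dots,\alpha_n(a,b),b)=a.$$ The same symbols denote the corresponding operations on $A$. $A$ is right-cancellable (with respect to these terms) if for every $i$ ($1\le i\le n$) and all $a_1,\dots,a_n,a_1',\dots,a_n',b,b'\in A$ $$\alpha_i(\theta(a_1,\dots,a_n,b),\theta(a_1',\dots,a_n',b))=\alpha_i(\theta(a_1,\dots,a_n,b'),\theta(a_1',\dots,a_n',b')).$$ *)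

theory Defs
  imports "HOL-Algebra.Group"
begin

text \<open>
  A signature is a type \<open>'f\<close> of operation symbols with an arity function. Terms use the
  variables \<open>V 0, V 1, ...\<close>; a \<open>k\<close>-ary term is a well-formed term whose variables are among
  the first \<open>k\<close> of them, the variable \<open>V j\<close> standing for the \<open>(j+1)\<close>-st argument.
\<close>

datatype 'f trm = V nat | Op 'f "'f trm list"

primrec trm_vars :: "'f trm \<Rightarrow> nat set" where
  "trm_vars (V x) = {x}"
| "trm_vars (Op f ts) = (\<Union>(set (map trm_vars ts)))"

primrec wf_trm :: "('f \<Rightarrow> nat) \<Rightarrow> 'f trm \<Rightarrow> bool" where
  "wf_trm ar (V x) = True"
| "wf_trm ar (Op f ts) = (length ts = ar f \<and> list_all (\<lambda>b. b) (map (wf_trm ar) ts))"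

definition nary_trm :: "('f \<Rightarrow> nat) \<Rightarrow> nat \<Rightarrow> 'f trm \<Rightarrow> bool" where
  "nary_trm ar k t \<longleftrightarrow> wf_trm ar t \<and> trm_vars t \<subseteq> {..<k}"

primrec trm_subst :: "(nat \<Rightarrow> 'f trm) \<Rightarrow> 'f trm \<Rightarrow> 'f trm" where
  "trm_subst \<sigma> (V x) = \<sigma> x"
| "trm_subst \<sigma> (Op f ts) = Op f (map (trm_subst \<sigma>) ts)"

text \<open>The composite term \<open>t(ts ! 0, ts ! 1, ...)\<close>; meant for \<open>length ts\<close>-ary \<open>t\<close>.\<close>

definition trm_comp :: "'f trm \<Rightarrow> 'f trm list \<Rightarrow> 'f trm" where
  "trm_comp t ts = trm_subst (\<lambda>k. if k < length ts then ts ! k else V k) t"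

text \<open>
  The algebraic theory presented by a set \<open>E\<close> of equations: two terms are identified in it iff
  their equality is derivable from \<open>E\<close> in equational logic.
\<close>

inductive theory_eq :: "('f \<Rightarrow> nat) \<Rightarrow> ('f trm \<times> 'f trm) set \<Rightarrow> 'f trm \<Rightarrow> 'f trm \<Rightarrow> bool"
  for ar :: "'f \<Rightarrow> nat" and E :: "('f trm \<times> 'f trm) set" where
  ax: "(s, t) \<in> E \<Longrightarrow> theory_eq ar E s t"
| rfl: "wf_trm ar t \<Longrightarrow> theory_eq ar E t t"
| symm: "theory_eq ar E s t \<Longrightarrow> theory_eq ar E t s"
| transitive: "theory_eq ar E r s \<Longrightarrow> theory_eq ar E s t \<Longrightarrow> theory_eq ar E r t"
| cong: "length ss = ar f \<Longrightarrow> length ts = ar f \<Longrightarrow>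
    (\<forall>j < ar f. theory_eq ar E (ss ! j) (ts ! j)) \<Longrightarrow> theory_eq ar E (Op f ss) (Op f ts)"
| inst: "theory_eq ar E s t \<Longrightarrow> (\<forall>x. wf_trm ar (\<sigma> x)) \<Longrightarrow>
    theory_eq ar E (trm_subst \<sigma> s) (trm_subst \<sigma> t)"

definition equations :: "('f \<Rightarrow> nat) \<Rightarrow> ('f trm \<times> 'f trm) set \<Rightarrow> bool" where
  "equations ar E \<longleftrightarrow> (\<forall>(s, t) \<in> E. wf_trm ar s \<and> wf_trm ar t)"

primrec trm_eval :: "('f \<Rightarrow> 'a list \<Rightarrow> 'a) \<Rightarrow> (nat \<Rightarrow> 'a) \<Rightarrow> 'f trm \<Rightarrow> 'a" where
  "trm_eval I \<rho> (V x) = \<rho> x"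
| "trm_eval I \<rho> (Op f ts) = I f (map (trm_eval I \<rho>) ts)"

definition algebra_of :: "('f \<Rightarrow> nat) \<Rightarrow> 'a set \<Rightarrow> ('f \<Rightarrow> 'a list \<Rightarrow> 'a) \<Rightarrow> bool" where
  "algebra_of ar A I \<longleftrightarrow> (\<forall>f xs. length xs = ar f \<and> set xs \<subseteq> A \<longrightarrow> I f xs \<in> A)"

definition in_variety ::
  "('f \<Rightarrow> nat) \<Rightarrow> ('f trm \<times> 'f trm) set \<Rightarrow> 'a set \<Rightarrow> ('f \<Rightarrow> 'a list \<Rightarrow> 'a) \<Rightarrow> bool" where
  "in_variety ar E A I \<longleftrightarrow> algebra_of ar A I \<and>
     (\<forall>(s, t) \<in> E. \<forall>\<rho>. range \<rho> \<subseteq> A \<longrightarrow> trm_eval I \<rho> s = trm_eval I \<rho> t)"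

text \<open>
  The operation induced by a \<open>k\<close>-ary term; only meaningful on argument lists of length \<open>k\<close>
  (the values of \<open>(!)\<close> beyond the length of the list are then never used).
\<close>

definition trm_op :: "('f \<Rightarrow> 'a list \<Rightarrow> 'a) \<Rightarrow> 'f trm \<Rightarrow> 'a list \<Rightarrow> 'a" where
  "trm_op I t xs = trm_eval I (\<lambda>k. xs ! k) t"

definition protomodular_terms ::
  "('f \<Rightarrow> nat) \<Rightarrow> ('f trm \<times> 'f trm) set \<Rightarrow> nat \<Rightarrow>
   (nat \<Rightarrow> 'f trm) \<Rightarrow> (nat \<Rightarrow> 'f trm) \<Rightarrow> 'f trm \<Rightarrow> bool" where
  "protomodular_terms ar E n e \<alpha> \<theta> \<longleftrightarrow>
     (\<forall>i\<in>{1..n}. nary_trm ar 0 (e i)) \<and>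
     (\<forall>i\<in>{1..n}. nary_trm ar 2 (\<alpha> i)) \<and>
     nary_trm ar (n + 1) \<theta> \<and>
     (\<forall>i\<in>{1..n}. theory_eq ar E (trm_comp (\<alpha> i) [V 0, V 0]) (e i)) \<and>
     theory_eq ar E
       (trm_comp \<theta> (map (\<lambda>i. trm_comp (\<alpha> i) [V 0, V 1]) [1..<n + 1] @ [V 1])) (V 0)"

definition protomodular_algebra ::
  "('f \<Rightarrow> nat) \<Rightarrow> ('f trm \<times> 'f trm) set \<Rightarrow> nat \<Rightarrow>
   (nat \<Rightarrow> 'f trm) \<Rightarrow> (nat \<Rightarrow> 'f trm) \<Rightarrow> 'f trm \<Rightarrow>
   'a set \<Rightarrow> ('f \<Rightarrow> 'a list \<Rightarrow> 'a) \<Rightarrow> bool" where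
  "protomodular_algebra ar E n e \<alpha> \<theta> A I \<longleftrightarrow>
     equations ar E \<and> protomodular_terms ar E n e \<alpha> \<theta> \<and> in_variety ar E A I"

definition right_cancellable ::
  "nat \<Rightarrow> (nat \<Rightarrow> 'f trm) \<Rightarrow> 'f trm \<Rightarrow> 'a set \<Rightarrow> ('f \<Rightarrow> 'a list \<Rightarrow> 'a) \<Rightarrow> bool" where
  "right_cancellable n \<alpha> \<theta> A I \<longleftrightarrow>
     (\<forall>i\<in>{1..n}. \<forall>as\<in>lists A. \<forall>as'\<in>lists A. \<forall>b\<in>A. \<forall>b'\<in>A.
        length as = n \<longrightarrow> length as' = n \<longrightarrow>
        trm_op I (\<alpha> i) [trm_op I \<theta> (as @ [b]), trm_op I \<theta> (as' @ [b])] =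
        trm_op I (\<alpha> i) [trm_op I \<theta> (as @ [b']), trm_op I \<theta> (as' @ [b'])])"

end

theory Submission
  imports Defs
begin

text \<open>
  Collect the values \<open>\<alpha>\<^sub>i(a, b)\<close> into one list \<open>d a b\<close>, a ``difference'' of \<open>a\<close> and \<open>b\<close>, and read
  \<open>\<theta>\<close> as letting a difference act on a point, \<open>T s b\<close>. The protomodular identities say that
  \<open>T (d a b) b = a\<close> and that \<open>d a a\<close> is the same for all \<open>a\<close>; so \<open>T\<close> moves \<open>b\<close> to \<open>a\<close> along their
  difference, and the constant difference moves nothing. The product is \<open>a \<cdot> b = T (d a u) b\<close>.

  Right cancellability says that differences are invariant under right translation:
  \<open>d (a \<cdot> c) (b \<cdot> c) = d a b\<close>. Associativity is then one computation,
  \<open>(a \<cdot> b) \<cdot> c = T (d ((a \<cdot> b) \<cdot> c) (b \<cdot> c)) (b \<cdot> c) = T (d (a \<cdot> b) b) (b \<cdot> c) = T (d a u) (b \<cdot> c) = a \<cdot> (b \<cdot> c)\<close>,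
  and the same invariance gives \<open>d (T (d u a) u) u = d u a\<close>, so that \<open>T (d u a) u\<close>, times \<open>a\<close>,
  is \<open>T (d u a) a = u\<close>. This reasoning is the content of the locale \<open>invariant_difference\<close>.

  The remaining work is to transport the protomodular identities, which hold in the algebraic
  theory, to the operations of the algebra, and this is the soundness of equational logic
  (\<open>theory_eq_sound\<close>).
\<close>

text \<open>
  Differences are kept abstract rather than taken to be lists, because the group laws depend
  only on the passage between points and differences; \<open>D\<close> is the set of differences that may act.
\<close>

locale invariant_difference =
  fixes A :: "'a set" and D :: "'d set" and d :: "'a \<Rightarrow> 'a \<Rightarrow> 'd" and T :: "'d \<Rightarrow> 'a \<Rightarrow> 'a"
  assumes diff_closed: "\<lbrakk>a \<in> A; b \<in> A\<rbrakk> \<Longrightarrow> d a b \<in> D"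
    and act_closed: "\<lbrakk>s \<in> D; b \<in> A\<rbrakk> \<Longrightarrow> T s b \<in> A"
    and diff_self: "\<lbrakk>a \<in> A; b \<in> A\<rbrakk> \<Longrightarrow> d a a = d b b"
    and act_diff: "\<lbrakk>a \<in> A; b \<in> A\<rbrakk> \<Longrightarrow> T (d a b) b = a"
    and diff_act: "\<lbrakk>s \<in> D; s' \<in> D; b \<in> A; b' \<in> A\<rbrakk> \<Longrightarrow> d (T s b) (T s' b) = d (T s b') (T s' b')"
begin

lemma act_diff_self: "\<lbrakk>a \<in> A; b \<in> A\<rbrakk> \<Longrightarrow> T (d a a) b = b"
  using diff_self[of a b] act_diff[of b b] by simp

text \<open>
  Distinct differences may act alike, so \<open>d (T s b) b\<close> need not be \<open>s\<close>; but this normal form of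
  \<open>s\<close> does not depend on the point \<open>b\<close> at which it is computed.
\<close>

lemma diff_act_base:
  assumes "s \<in> D" "b \<in> A" "c \<in> A"
  shows "d (T s b) b = d (T s c) c"
  \<comment> \<open>The base points themselves are images under the trivial difference.\<close>
  using diff_act[of s "d b b" b c] assms by (simp add: act_diff_self diff_closed)

lemma diff_mult_right:
  assumes "a \<in> A" "b \<in> A" "c \<in> A" "u \<in> A"
  shows "d (T (d a u) c) (T (d b u) c) = d a b"
  using diff_act[of "d a u" "d b u" c u] assms by (simp add: act_diff diff_closed)

lemma mult_assoc:
  assumes "a \<in> A" "b \<in> A" "c \<in> A" "u \<in> A"
  shows "T (d (T (d a u) b) u) c = T (d a u) (T (d b u) c)"
proof -
  let ?ab = "T (d a u) b" and ?bc = "T (d b u) c"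
  have closed: "?ab \<in> A" "?bc \<in> A" "T (d ?ab u) c \<in> A"
    using assms by (simp_all add: act_closed diff_closed)
  have "d (T (d ?ab u) c) ?bc = d ?ab b"
    using assms closed by (simp add: diff_mult_right)
  also have "\<dots> = d a u"
    using assms diff_act_base[of "d a u" b u] by (simp add: act_diff diff_closed)
  finally show ?thesis
    using act_diff[of "T (d ?ab u) c" ?bc] closed by simp
qed

lemma left_inverse:
  assumes "a \<in> A" "u \<in> A"
  shows "T (d (T (d u a) u) u) a = u"
  using assms diff_act_base[of "d u a" u a] by (simp add: act_diff diff_closed)

theorem group_with_inverse:
  assumes u: "u \<in> A"
  defines "G \<equiv> \<lparr>carrier = A, monoid.mult = (\<lambda>a b. T (d a u) b), one = u\<rparr>"
  shows "group G \<and> (\<forall>a\<in>A. inv\<^bsub>G\<^esub> a = T (d u a) u)"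
proof -
  have G: "group G"
  proof (rule groupI)
    show "\<exists>y\<in>carrier G. y \<otimes>\<^bsub>G\<^esub> x = \<one>\<^bsub>G\<^esub>" if "x \<in> carrier G" for x
      using that u left_inverse[of x u]
      by (auto simp: G_def act_closed diff_closed intro!: bexI[of _ "T (d u x) u"])
  qed (use u in \<open>simp_all add: G_def act_closed diff_closed act_diff_self mult_assoc\<close>)
  moreover have "inv\<^bsub>G\<^esub> a = T (d u a) u" if "a \<in> A" for a
    by (rule group.inv_equality[OF G])
      (use that u in \<open>simp_all add: G_def act_closed diff_closed left_inverse\<close>)
  ultimately show ?thesis by blast
qed

end

lemma trm_eval_cong:
  "(\<And>x. x \<in> trm_vars t \<Longrightarrow> \<rho> x = \<rho>' x) \<Longrightarrow> trm_eval I \<rho> t = trm_eval I \<rho>' t"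
proof (induction t)
  case (Op f ts)
  then have "map (trm_eval I \<rho>) ts = map (trm_eval I \<rho>') ts" by auto
  then show ?case by (simp only: trm_eval.simps)
qed simp

lemma trm_eval_subst: "trm_eval I \<rho> (trm_subst \<sigma> t) = trm_eval I (\<lambda>x. trm_eval I \<rho> (\<sigma> x)) t"
proof (induction t)
  case (Op f ts)
  then have "map (trm_eval I \<rho> \<circ> trm_subst \<sigma>) ts = map (trm_eval I (\<lambda>x. trm_eval I \<rho> (\<sigma> x))) ts"
    by simp
  then show ?case by (simp only: trm_subst.simps trm_eval.simps map_map)
qed simp

text \<open>
  Membership in \<open>A\<close> is demanded only for the variables that occur, since the valuation behind
  \<open>trm_op\<close> takes arbitrary values beyond the end of the argument list.
\<close>

lemma trm_eval_closed:
  assumes "algebra_of ar A I"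
  shows "\<lbrakk>wf_trm ar t; \<rho> ` trm_vars t \<subseteq> A\<rbrakk> \<Longrightarrow> trm_eval I \<rho> t \<in> A"
proof (induction t)
  case (Op f ts)
  have "set (map (trm_eval I \<rho>) ts) \<subseteq> A"
    using Op by (auto simp: list_all_iff image_subset_iff)
  then show ?case
    using assms Op.prems by (simp add: algebra_of_def)
qed simp

lemma trm_op_closed:
  assumes "algebra_of ar A I" "nary_trm ar (length xs) t" "set xs \<subseteq> A"
  shows "trm_op I t xs \<in> A"
  unfolding trm_op_def
proof (rule trm_eval_closed[OF assms(1)])
  show "(!) xs ` trm_vars t \<subseteq> A"
    using assms(2,3) nth_mem by (fastforce simp: nary_trm_def)
qed (use assms(2) in \<open>simp add: nary_trm_def\<close>)

lemma trm_eval_comp: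
  assumes "nary_trm ar (length ts) t"
  shows "trm_eval I \<rho> (trm_comp t ts) = trm_op I t (map (trm_eval I \<rho>) ts)"
  unfolding trm_comp_def trm_op_def trm_eval_subst
  by (rule trm_eval_cong) (use assms in \<open>auto simp: nary_trm_def\<close>)

lemma theory_eq_sound:
  assumes "theory_eq ar E s t" and "in_variety ar E A I" and "range \<rho> \<subseteq> A"
  shows "trm_eval I \<rho> s = trm_eval I \<rho> t"
  using assms(1,3)
proof (induction arbitrary: \<rho> rule: theory_eq.induct)
  case (ax s t)
  then show ?case using assms(2) by (auto simp: in_variety_def)
next
  case (cong ss f ts)
  then have "map (trm_eval I \<rho>) ss = map (trm_eval I \<rho>) ts"
    by (auto intro: nth_equalityI)
  then show ?case by (simp only: trm_eval.simps)
next
  case (inst s t \<sigma>)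
  \<comment> \<open>Here it matters that \<open>\<sigma>\<close> is well-formed: the composite valuation must stay inside \<open>A\<close>.\<close>
  have "range (\<lambda>x. trm_eval I \<rho> (\<sigma> x)) \<subseteq> A"
  proof (rule image_subsetI)
    show "trm_eval I \<rho> (\<sigma> x) \<in> A" for x
      by (rule trm_eval_closed[of ar]) (use inst.hyps inst.prems assms(2) in \<open>auto simp: in_variety_def\<close>)
  qed
  then show ?case by (simp add: trm_eval_subst inst.IH)
qed auto

lemma protomodular_diff_self:
  assumes "protomodular_algebra ar E n e \<alpha> \<theta> A I" "i \<in> {1..n}" "a \<in> A" "b \<in> A"
  shows "trm_op I (\<alpha> i) [a, a] = trm_op I (\<alpha> i) [b, b]"
proof -
  have nary: "nary_trm ar 2 (\<alpha> i)" "nary_trm ar 0 (e i)"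
    and eq: "theory_eq ar E (trm_comp (\<alpha> i) [V 0, V 0]) (e i)"
    and var: "in_variety ar E A I"
    using assms(1,2) by (auto simp: protomodular_algebra_def protomodular_terms_def)
  have "trm_op I (\<alpha> i) [c, c] = trm_eval I (\<lambda>_. c) (e i)" if "c \<in> A" for c
    using theory_eq_sound[OF eq var, of "\<lambda>_. c"] trm_eval_comp[of ar "[V 0, V 0]" "\<alpha> i" I "\<lambda>_. c"]
      nary(1) that by (simp add: numeral_2_eq_2)
  \<comment> \<open>A nullary term has no variables, so its value does not see the valuation.\<close>
  moreover have "trm_eval I (\<lambda>_. a) (e i) = trm_eval I (\<lambda>_. b) (e i)"
    by (rule trm_eval_cong) (use nary(2) in \<open>auto simp: nary_trm_def\<close>)
  ultimately show ?thesis using assms(3,4) by simp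
qed

lemma protomodular_act_diff:
  assumes "protomodular_algebra ar E n e \<alpha> \<theta> A I" "a \<in> A" "b \<in> A"
  shows "trm_op I \<theta> (map (\<lambda>i. trm_op I (\<alpha> i) [a, b]) [1..<n + 1] @ [b]) = a"
proof -
  let ?\<rho> = "\<lambda>k::nat. if k = 0 then a else b"
  let ?ts = "map (\<lambda>i. trm_comp (\<alpha> i) [V 0, V 1]) [1..<n + 1] @ [V 1]"
  have nary: "\<forall>i\<in>{1..n}. nary_trm ar 2 (\<alpha> i)" "nary_trm ar (n + 1) \<theta>"
    and eq: "theory_eq ar E (trm_comp \<theta> ?ts) (V 0)"
    and var: "in_variety ar E A I"
    using assms(1) by (auto simp: protomodular_algebra_def protomodular_terms_def)
  have "trm_eval I ?\<rho> (trm_comp (\<alpha> i) [V 0, V 1]) = trm_op I (\<alpha> i) [a, b]" if "i \<in> {1..n}" for i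
    using trm_eval_comp[of ar "[V 0, V 1]" "\<alpha> i" I ?\<rho>] nary(1) that
    by (simp add: numeral_2_eq_2)
  then have "map (trm_eval I ?\<rho>) ?ts = map (\<lambda>i. trm_op I (\<alpha> i) [a, b]) [1..<n + 1] @ [b]"
    by (simp del: upt_Suc)
  moreover have "trm_eval I ?\<rho> (trm_comp \<theta> ?ts) = trm_op I \<theta> (map (trm_eval I ?\<rho>) ?ts)"
    by (rule trm_eval_comp[of ar]) (use nary(2) in \<open>simp del: upt_Suc\<close>)
  moreover have "trm_eval I ?\<rho> (trm_comp \<theta> ?ts) = a"
    using theory_eq_sound[OF eq var, of ?\<rho>] assms(2,3)
    by (simp add: image_subset_iff del: upt_Suc)
  ultimately show ?thesis by (simp only:)
qed

lemma right_cancellable_invariant_difference: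
  assumes proto: "protomodular_algebra ar E n e \<alpha> \<theta> A I"
    and canc: "right_cancellable n \<alpha> \<theta> A I"
  shows "invariant_difference A {xs \<in> lists A. length xs = n}
    (\<lambda>a b. map (\<lambda>i. trm_op I (\<alpha> i) [a, b]) [1..<n + 1]) (\<lambda>s b. trm_op I \<theta> (s @ [b]))"
proof -
  have nary: "\<forall>i\<in>{1..n}. nary_trm ar 2 (\<alpha> i)" "nary_trm ar (n + 1) \<theta>"
    and alg: "algebra_of ar A I"
    using proto
    by (auto simp: protomodular_algebra_def protomodular_terms_def in_variety_def)
  have op_closed: "trm_op I (\<alpha> i) [a, b] \<in> A" if "i \<in> {1..n}" "a \<in> A" "b \<in> A" for i a b
    by (rule trm_op_closed[OF alg]) (use that nary(1) in \<open>auto simp: numeral_2_eq_2\<close>)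
  show ?thesis
  proof
    fix a b assume "a \<in> A" "b \<in> A"
    then show "map (\<lambda>i. trm_op I (\<alpha> i) [a, b]) [1..<n + 1] \<in> {xs \<in> lists A. length xs = n}"
      using op_closed by (auto simp del: upt_Suc)
    show "map (\<lambda>i. trm_op I (\<alpha> i) [a, a]) [1..<n + 1] = map (\<lambda>i. trm_op I (\<alpha> i) [b, b]) [1..<n + 1]"
      using protomodular_diff_self[OF proto _ \<open>a \<in> A\<close> \<open>b \<in> A\<close>] by (auto simp del: upt_Suc)
    show "trm_op I \<theta> (map (\<lambda>i. trm_op I (\<alpha> i) [a, b]) [1..<n + 1] @ [b]) = a"
      using protomodular_act_diff[OF proto \<open>a \<in> A\<close> \<open>b \<in> A\<close>] .
  next
    fix s b assume "s \<in> {xs \<in> lists A. length xs = n}" "b \<in> A"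
    then show "trm_op I \<theta> (s @ [b]) \<in> A"
      by (intro trm_op_closed[OF alg]) (use nary(2) in auto)
  next
    fix s s' b b'
    assume *: "s \<in> {xs \<in> lists A. length xs = n}" "s' \<in> {xs \<in> lists A. length xs = n}"
      "b \<in> A" "b' \<in> A"
    have "trm_op I (\<alpha> i) [trm_op I \<theta> (s @ [b]), trm_op I \<theta> (s' @ [b])] =
        trm_op I (\<alpha> i) [trm_op I \<theta> (s @ [b']), trm_op I \<theta> (s' @ [b'])]" if "i \<in> {1..n}" for i
      using canc * that unfolding right_cancellable_def by blast
    then show "map (\<lambda>i. trm_op I (\<alpha> i) [trm_op I \<theta> (s @ [b]), trm_op I \<theta> (s' @ [b])]) [1..<n + 1] =
        map (\<lambda>i. trm_op I (\<alpha> i) [trm_op I \<theta> (s @ [b']), trm_op I \<theta> (s' @ [b'])]) [1..<n + 1]"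
      by (intro map_cong) auto
  qed
qed

theorem proposition5p1:
  fixes n :: nat
    and ar :: "'f \<Rightarrow> nat" and E :: "('f trm \<times> 'f trm) set"
    and e \<alpha> :: "nat \<Rightarrow> 'f trm" and \<theta> :: "'f trm"
    and A :: "'a set" and I :: "'f \<Rightarrow> 'a list \<Rightarrow> 'a" and u :: 'a
  assumes "n \<ge> 1"
    and "protomodular_algebra ar E n e \<alpha> \<theta> A I"
    and "right_cancellable n \<alpha> \<theta> A I"
    and "u \<in> A"
  defines "G \<equiv> \<lparr>carrier = A,
      monoid.mult = (\<lambda>a b. trm_op I \<theta> (map (\<lambda>i. trm_op I (\<alpha> i) [a, u]) [1..<n + 1] @ [b])),
      one = u\<rparr>"
  shows "group G \<and>
    (\<forall>a\<in>A. inv\<^bsub>G\<^esub> a = trm_op I \<theta> (map (\<lambda>i. trm_op I (\<alpha> i) [u, a]) [1..<n + 1] @ [u]))"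
  unfolding G_def
  by (rule invariant_difference.group_with_inverse
      [OF right_cancellable_invariant_difference[OF assms(2,3)] assms(4)])

end
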